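(* Let $\mathcal{H}$ be a Hilbert space and let $\mathcal{L}:\mathcal{D}(\mathcal{L})\subset\mathcal{H}\to\mathcal{H}$ be a densely defined linear operator such that: (1) $\mathcal{L}=\mathcal{L}^*$; (2) there is $\gamma>0$ with $\langle\phi,\mathcal{L}\phi\rangle\le-\gamma\|\phi\|^2$ for all $\phi\in\mathcal{D}(\mathcal{L})$; (3) $\mathcal{H}$ has a complete orthonormal system $\{\phi_k\}_{k=1}^\infty$ of eigenfunctions of $\mathcal{L}$, $\mathcal{L}\phi_k=\lambda_k\phi_k$, with real eigenvalues $\lambda_k<0$; (4) $\mathcal{L}$ generates a strongly continuous semigroup $\{e^{\mathcal{L}t}\}_{t\ge0}$ on $\mathcal{H}$ with $\|e^{\mathcal{L}t}\|\le e^{-\gamma t}$ for all $t\ge0$, with $\gamma$ as in (2). Let $Q:\mathcal{H}\to\mathcal{H}$ be a bounded positive self-adjoint operator, and let $P:\mathcal{H}\to\mathcal{H}$ be the energy covariance operator, defined by $$\langle\phi,P\psi\rangle=\int_0^\infty\langle\phi,e^{\mathcal{L}t}Qe^{\mathcal{L}t}\psi\rangle\,\mathrm{d}t\qquad\text{for all }\phi,\psi\in\mathcal{H}.$$ Let $N\ge1$, and let $P_N$ and $Q_N$ be the $N\times N$ matrices with entries $(P_N)_{jk}=\langle\phi_j,P\phi_k\rangle$ and $(Q_N)_{jk}=\langle\phi_j,Q\phi_k\rangle$, $1\le j,k\le N$, and let $\Lambda=\mathrm{diag}(\lambda_1,\ldots,\lambda_N)$. Then $$\Lambda P_N+P_N\Lambda=-Q_N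 .$$
   Context: $\langle\cdot,\cdot\rangle$ is the inner product of $\mathcal{H}$ (linear in the second argument), $\|\cdot\|$ the induced norm on vectors and the operator norm on bounded operators. "Positive" means $\langle\phi,Q\phi\rangle\ge0$ for all $\phi\in\mathcal{H}$. The matrix $P_N$ is the matrix, in the basis $\phi_1,\ldots,\phi_N$, of the finite-dimensional energy covariance $\Pi_NP\Pi_N$, where $\Pi_N$ is the orthogonal projection onto $\mathrm{span}\{\phi_1,\ldots,\phi_N\}$. *)

theory Defs
  imports "HOL-Analysis.Analysis" "Jordan_Normal_Form.Matrix"
begin

section \<open>Scalars\<close>

text \<open>
  The scalar field is a type of sort \<open>{real_normed_field, euclidean_space}\<close>. Up to isometric
  isomorphism the only such types are the real and the complex numbers, so real and complex Hilbert
  spaces are treated simultaneously. In both cases \<open>inner x 1\<close> is the real part of \<open>x\<close>, which gives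
  a uniform formula for conjugation.
\<close>

definition scalar_cnj :: "'k::{real_normed_field, euclidean_space} \<Rightarrow> 'k"
  where "scalar_cnj x = of_real (2 * inner x 1) - x"

lemma scalar_cnj_complex: "scalar_cnj (z::complex) = cnj z"
  by (simp add: scalar_cnj_def complex_eq_iff inner_complex_def)

lemma scalar_cnj_real: "scalar_cnj (r::real) = r"
  by (simp add: scalar_cnj_def)

text \<open>By the next lemma every scalar \<open>x\<close> is a root of a real quadratic polynomial (note that
  \<open>x + scalar_cnj x\<close> is real), which leaves only the two fields above.\<close>

lemma mult_scalar_cnj:
  fixes x :: "'k::{real_normed_field, euclidean_space}"
  shows "x * scalar_cnj x = of_real ((norm x)\<^sup>2)"
proof -
  define a where "a = inner x 1"
  define u where "u = x - of_real a"
  have n1: "inner (1::'k) 1 = 1"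
    by (simp add: dot_square_norm)
  have u1: "inner u 1 = 0"
    by (simp add: u_def a_def of_real_def inner_diff_left n1)
  have x: "x = of_real a + u"
    by (simp add: u_def)
  have nplus: "(norm (1 + u))\<^sup>2 = 1 + (norm u)\<^sup>2"
    using u1 by (simp add: power2_norm_eq_inner inner_simps n1 inner_commute)
  have nminus: "(norm (1 - u))\<^sup>2 = 1 + (norm u)\<^sup>2"
    using u1 by (simp add: power2_norm_eq_inner inner_simps n1 inner_commute)
  have "norm (1 - u * u) = norm (1 + u) * norm (1 - u)"
    by (simp add: norm_mult [symmetric] algebra_simps)
  then have sq: "(norm (1 - u * u))\<^sup>2 = (1 + (norm u)\<^sup>2)\<^sup>2"
    by (simp add: power_mult_distrib nplus nminus power2_eq_square [of "1 + _"])
  have nuu: "inner (u * u) (u * u) = ((norm u)\<^sup>2)\<^sup>2"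
    by (simp only: power2_norm_eq_inner [symmetric] norm_mult power_mult_distrib
        power2_eq_square)
  have iuu: "inner (u * u) 1 = - ((norm u)\<^sup>2)"
  proof -
    have "(norm (1 - u * u))\<^sup>2 = 1 - 2 * inner (u * u) 1 + ((norm u)\<^sup>2)\<^sup>2"
      by (simp only: power2_norm_eq_inner inner_diff_left inner_diff_right n1 nuu
          inner_commute [of 1 "u * u"])
    with sq show ?thesis by (simp add: power2_eq_square algebra_simps)
  qed
  have "inner (u * u + of_real ((norm u)\<^sup>2)) (u * u + of_real ((norm u)\<^sup>2)) = 0"
    by (simp only: of_real_def inner_add_left inner_add_right inner_scaleR_left inner_scaleR_right
        inner_commute [of 1 "u * u"] iuu nuu n1) (simp add: power2_eq_square)
  then have uu: "u * u = - of_real ((norm u)\<^sup>2)"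
    by (simp only: inner_eq_zero_iff eq_neg_iff_add_eq_0)
  have nx: "(norm x)\<^sup>2 = a\<^sup>2 + (norm u)\<^sup>2"
    by (simp only: x power2_norm_eq_inner inner_add_left inner_add_right of_real_def n1 u1
        inner_scaleR_left inner_scaleR_right inner_commute [of 1 u]) (simp add: power2_eq_square)
  have "scalar_cnj x = of_real a - u"
    by (simp add: scalar_cnj_def u_def flip: a_def)
  then have "x * scalar_cnj x = (of_real a)\<^sup>2 - u * u"
    using x by (metis power2_eq_square square_diff_square_factored)
  then show ?thesis
    by (simp add: uu nx)
qed

text \<open>The usual partial order: the difference is real and nonnegative
  (so that \<open>z\<close> is real as soon as one of \<open>z \<le> r\<close>, \<open>r \<le> z\<close> holds with \<open>r\<close> real).\<close>

definition scalar_le :: "'k::real_normed_field \<Rightarrow> 'k \<Rightarrow> bool"  (infix \<open>\<le>\<^sub>K\<close> 50)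
  where "z \<le>\<^sub>K w \<longleftrightarrow> (\<exists>r\<ge>0. w - z = of_real r)"

section \<open>Hilbert spaces\<close>

text \<open>Completeness comes from the sort \<open>banach\<close>; the axioms below say that the norm and the real
  scaling of the type are those of the inner product space.\<close>

locale hilbert_space = Vector_Spaces.vector_space scl
  for scl :: "'k::{real_normed_field, euclidean_space} \<Rightarrow> 'h::banach \<Rightarrow> 'h" +
  fixes ip :: "'h \<Rightarrow> 'h \<Rightarrow> 'k"
  assumes scale_of_real: "scl (of_real r) x = r *\<^sub>R x"
    and ip_cnj: "ip y x = scalar_cnj (ip x y)"
    and ip_add_right: "ip x (y + z) = ip x y + ip x z"
    and ip_scale_right: "ip x (scl c y) = c * ip x y"
    and ip_self: "ip x x = of_real ((norm x)\<^sup>2)"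

lemma hilbert_space_real: "hilbert_space (scaleR :: real \<Rightarrow> 'h \<Rightarrow> 'h::{real_inner, banach}) inner"
  by unfold_locales
     (simp_all add: algebra_simps scalar_cnj_real inner_commute power2_norm_eq_inner)

lemma hilbert_space_complex: "hilbert_space (*) (\<lambda>x y. cnj x * y :: complex)"
proof unfold_locales
  show "cnj x * x = of_real ((norm x)\<^sup>2)" for x :: complex
    by (simp only: complex_norm_square mult.commute)
qed (simp_all add: algebra_simps scalar_cnj_complex scaleR_conv_of_real)

text \<open>A complete orthonormal system: orthonormal, with dense linear span.\<close>

definition complete_orthonormal ::
    "('k::{real_normed_field, euclidean_space} \<Rightarrow> 'h::banach \<Rightarrow> 'h) \<Rightarrow> ('h \<Rightarrow> 'h \<Rightarrow> 'k) \<Rightarrow> (nat \<Rightarrow> 'h) \<Rightarrow> bool"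
  where "complete_orthonormal scl ip \<phi> \<longleftrightarrow>
    (\<forall>j k. ip (\<phi> j) (\<phi> k) = (if j = k then 1 else 0)) \<and>
    closure (Modules.module.span scl (range \<phi>)) = UNIV"

section \<open>Operators\<close>

text \<open>An operator with domain \<open>D\<close> is a total function whose values outside \<open>D\<close> are irrelevant.\<close>

definition densely_defined_linear ::
    "('k::{real_normed_field, euclidean_space} \<Rightarrow> 'h::banach \<Rightarrow> 'h) \<Rightarrow> 'h set \<Rightarrow> ('h \<Rightarrow> 'h) \<Rightarrow> bool"
  where "densely_defined_linear scl D T \<longleftrightarrow>
    Modules.module.subspace scl D \<and> closure D = UNIV \<and>
    (\<forall>x\<in>D. \<forall>y\<in>D. T (x + y) = T x + T y) \<and> (\<forall>c. \<forall>x\<in>D. T (scl c x) = scl c (T x))"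

definition bounded_operator ::
    "('k::{real_normed_field, euclidean_space} \<Rightarrow> 'h::banach \<Rightarrow> 'h) \<Rightarrow> ('h \<Rightarrow> 'h) \<Rightarrow> bool"
  where "bounded_operator scl T \<longleftrightarrow> bounded_linear T \<and> (\<forall>c x. T (scl c x) = scl c (T x))"

definition adjoint_domain :: "('h \<Rightarrow> 'h \<Rightarrow> 'k) \<Rightarrow> 'h set \<Rightarrow> ('h \<Rightarrow> 'h) \<Rightarrow> 'h set"
  where "adjoint_domain ip D T = {\<psi>. \<exists>\<eta>. \<forall>x\<in>D. ip \<psi> (T x) = ip \<eta> x}"

text \<open>The vector below is unique when \<open>D\<close> is dense and \<open>\<psi>\<close> lies in \<^term>\<open>adjoint_domain ip D T\<close>.\<close>

definition adjoint_op :: "('h \<Rightarrow> 'h \<Rightarrow> 'k) \<Rightarrow> 'h set \<Rightarrow> ('h \<Rightarrow> 'h) \<Rightarrow> 'h \<Rightarrow> 'h"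
  where "adjoint_op ip D T \<psi> = (THE \<eta>. \<forall>x\<in>D. ip \<psi> (T x) = ip \<eta> x)"

definition self_adjoint :: "('h \<Rightarrow> 'h \<Rightarrow> 'k) \<Rightarrow> 'h set \<Rightarrow> ('h \<Rightarrow> 'h) \<Rightarrow> bool"
  where "self_adjoint ip D T \<longleftrightarrow> adjoint_domain ip D T = D \<and> (\<forall>\<psi>\<in>D. adjoint_op ip D T \<psi> = T \<psi>)"

definition positive_operator :: "('h \<Rightarrow> 'h \<Rightarrow> 'k::real_normed_field) \<Rightarrow> ('h \<Rightarrow> 'h) \<Rightarrow> bool"
  where "positive_operator ip T \<longleftrightarrow> (\<forall>x. 0 \<le>\<^sub>K ip x (T x))"

section \<open>Semigroups\<close>

text \<open>Only the values \<open>S t\<close> with \<open>t \<ge> 0\<close> matter.\<close>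

definition strongly_continuous_semigroup ::
    "('k::{real_normed_field, euclidean_space} \<Rightarrow> 'h::banach \<Rightarrow> 'h) \<Rightarrow> (real \<Rightarrow> 'h \<Rightarrow> 'h) \<Rightarrow> bool"
  where "strongly_continuous_semigroup scl S \<longleftrightarrow>
    (\<forall>t\<ge>0. bounded_operator scl (S t)) \<and> S 0 = id \<and>
    (\<forall>s\<ge>0. \<forall>t\<ge>0. S (s + t) = S s \<circ> S t) \<and>
    (\<forall>x. ((\<lambda>t. S t x) \<longlongrightarrow> x) (at_right 0))"

text \<open>The domain \<open>D\<close> is exactly the set of vectors at which the difference quotients converge.\<close>

definition generates :: "'h set \<Rightarrow> ('h \<Rightarrow> 'h::real_normed_vector) \<Rightarrow> (real \<Rightarrow> 'h \<Rightarrow> 'h) \<Rightarrow> bool"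
  where "generates D T S \<longleftrightarrow>
    D = {x. \<exists>y. ((\<lambda>t. (S t x - x) /\<^sub>R t) \<longlongrightarrow> y) (at_right 0)} \<and>
    (\<forall>x\<in>D. ((\<lambda>t. (S t x - x) /\<^sub>R t) \<longlongrightarrow> T x) (at_right 0))"

text \<open>\<open>P = \<integral>\<^sub>0\<^sup>\<infinity> S t Q S t dt\<close> in the weak sense.\<close>

definition energy_covariance ::
    "('h \<Rightarrow> 'h \<Rightarrow> 'k::{real_normed_field, euclidean_space}) \<Rightarrow> (real \<Rightarrow> 'h \<Rightarrow> 'h) \<Rightarrow> ('h \<Rightarrow> 'h) \<Rightarrow> ('h \<Rightarrow> 'h) \<Rightarrow> bool"
  where "energy_covariance ip S Q P \<longleftrightarrow>
    (\<forall>x y. ip x (P y) = (LINT t:{0..}|lborel. ip x (S t (Q (S t y)))))"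

section \<open>Matrices in an orthonormal system\<close>

text \<open>Indices start at \<open>0\<close>, for the matrices as well as for the orthonormal system:
  \<open>\<phi> k\<close> stands for \<open>\<phi>\<^sub>k\<^sub>+\<^sub>1\<close>.\<close>

definition op_mat :: "('h \<Rightarrow> 'h \<Rightarrow> 'k) \<Rightarrow> (nat \<Rightarrow> 'h) \<Rightarrow> nat \<Rightarrow> ('h \<Rightarrow> 'h) \<Rightarrow> 'k mat"
  where "op_mat ip \<phi> N T = Matrix.mat N N (\<lambda>(j, k). ip (\<phi> j) (T (\<phi> k)))"

end

theory Submission
  imports Defs
begin

text \<open>
  On an eigenvector \<open>\<phi>\<^sub>k\<close> of the generator the semigroup acts as multiplication by
  \<open>exp (\<lambda>\<^sub>k t)\<close> (\<open>semigroup_eigenvector\<close>). Since the \<open>\<phi>\<^sub>k\<close> are orthonormal with dense span,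
  the semigroup can then also be moved off the second argument of the inner product:
  \<open>\<langle>\<phi>\<^sub>j, S t y\<rangle> = exp (\<lambda>\<^sub>j t) \<langle>\<phi>\<^sub>j, y\<rangle>\<close> for every \<open>y\<close> (\<open>ip_diagonal_operator\<close>). Hence the
  integrand that defines \<open>\<langle>\<phi>\<^sub>j, P \<phi>\<^sub>k\<rangle>\<close> is \<open>exp ((\<lambda>\<^sub>j + \<lambda>\<^sub>k) t) \<langle>\<phi>\<^sub>j, Q \<phi>\<^sub>k\<rangle>\<close>, an exponential
  times a constant, and its integral over the half line is
  \<open>- \<langle>\<phi>\<^sub>j, Q \<phi>\<^sub>k\<rangle> / (\<lambda>\<^sub>j + \<lambda>\<^sub>k)\<close>. Multiplying by \<open>\<lambda>\<^sub>j + \<lambda>\<^sub>k\<close> gives the \<open>(j, k)\<close> entry of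
  the Lyapunov equation.
\<close>

lemma set_integral_exp_Ici:
  fixes a :: real
  assumes "a < 0"
  shows "set_integrable lborel {0..} (\<lambda>t. exp (a * t))"
    and "(LINT t:{0..}|lborel. exp (a * t)) = - 1 / a"
proof -
  have lim: "((\<lambda>t. exp (a * t) / a) \<longlongrightarrow> 0) at_top"
    using assms by (auto intro!: tendsto_divide_zero filterlim_compose[OF exp_at_bot]
        filterlim_tendsto_neg_mult_at_bot[OF tendsto_const] filterlim_ident)
  have "(\<integral>\<^sup>+ t. ennreal (exp (a * t)) * indicator {0..} t \<partial>lborel) = ennreal (0 - exp (a * 0) / a)"
    using assms lim
    by (intro nn_integral_FTC_atLeast)
       (auto intro!: derivative_eq_intros)
  then have "has_bochner_integral lborel (\<lambda>t. indicator {0..} t *\<^sub>R exp (a * t)) (- 1 / a)"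
    using assms
    by (intro has_bochner_integral_nn_integral)
       (auto simp: indicator_def if_distrib[of ennreal] field_simps intro!: nn_integral_cong
         elim!: trans[rotated])
  then show "set_integrable lborel {0..} (\<lambda>t. exp (a * t))"
    "(LINT t:{0..}|lborel. exp (a * t)) = - 1 / a"
    by (auto simp: set_integrable_def set_lebesgue_integral_def has_bochner_integral_iff)
qed

lemma scalar_cnj_of_real [simp]:
  "scalar_cnj (of_real r :: 'k::{real_normed_field, euclidean_space}) = of_real r"
  by (simp add: scalar_cnj_def of_real_def dot_square_norm algebra_simps flip: scaleR_add_left)

context hilbert_space
begin

lemma ip_scaleR_right: "ip x (r *\<^sub>R y) = r *\<^sub>R ip x y"
  by (metis ip_scale_right scale_of_real scaleR_conv_of_real)

text \<open>The case of Bessel's inequality with a single unit vector \<open>x\<close>: subtract from \<open>y\<close> its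
  projection \<open>scl (ip x y) x\<close> and apply Pythagoras.\<close>

lemma norm_ip_le:
  assumes "norm x = 1"
  shows "norm (ip x y) \<le> norm y"
proof -
  define c where "c = ip x y"
  define z where "z = y - scl c x"
  have y: "y = z + scl c x"
    by (simp add: z_def)
  have x1: "ip x x = 1"
    using assms by (simp add: ip_self)
  have "ip x y = ip x z + c * ip x x"
    by (metis y ip_add_right ip_scale_right)
  then have xz: "ip x z = 0"
    using x1 by (simp flip: c_def)
  have zx: "ip z x = 0"
    using ip_cnj[of z x] scalar_cnj_of_real[of 0] xz by simp
  have "ip z y = of_real ((norm z)\<^sup>2)"
    by (subst y) (simp add: ip_add_right ip_scale_right zx ip_self)
  then have yz: "ip y z = of_real ((norm z)\<^sup>2)"
    using ip_cnj[of y z] by (simp only: scalar_cnj_of_real)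
  have "of_real ((norm y)\<^sup>2) = ip y z + c * ip y x"
    by (metis ip_self y ip_add_right ip_scale_right)
  also have "\<dots> = (of_real ((norm z)\<^sup>2 + (norm c)\<^sup>2) :: 'k)"
    using mult_scalar_cnj[of c] ip_cnj[of y x] yz by (simp flip: c_def)
  finally have "(norm y)\<^sup>2 = (norm z)\<^sup>2 + (norm c)\<^sup>2"
    by (simp only: of_real_eq_iff)
  then have "(norm c)\<^sup>2 \<le> (norm y)\<^sup>2"
    by simp
  then show ?thesis
    unfolding c_def by (rule power2_le_imp_le) simp
qed

lemma bounded_linear_ip:
  assumes "norm x = 1"
  shows "bounded_linear (ip x)"
  by (rule bounded_linear_intro[of _ 1])
     (simp_all add: ip_add_right ip_scaleR_right norm_ip_le[OF assms])

lemma norm_orthonormal: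
  assumes "complete_orthonormal scl ip \<phi>"
  shows "norm (\<phi> j) = 1"
proof -
  have "of_real ((norm (\<phi> j))\<^sup>2) = (of_real 1 :: 'k)"
    using assms ip_self[of "\<phi> j"] by (simp add: complete_orthonormal_def)
  then have "(norm (\<phi> j))\<^sup>2 = 1"
    by (simp only: of_real_eq_iff)
  then show ?thesis
    using norm_ge_zero[of "\<phi> j"] by (simp add: power2_eq_1_iff)
qed

end

text \<open>
  For \<open>h = t / n\<close> the difference of \<open>S (n h) x\<close> and \<open>exp (a n h) x\<close> telescopes into \<open>n\<close> errors of
  a single step of length \<open>h\<close>. Neither \<open>S\<close> nor multiplication by \<open>exp (a h)\<close> expands distances, so
  the total error is at most \<open>n\<close> times that of one step. As \<open>x\<close> is an eigenvector of the generator,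
  both curves have the same derivative at \<open>0\<close>; the error of one step is therefore \<open>o(h)\<close>, and the total
  error tends to \<open>0\<close> as \<open>n \<rightarrow> \<infinity>\<close>.
\<close>

lemma semigroup_eigenvector:
  fixes S :: "real \<Rightarrow> 'h::real_normed_vector \<Rightarrow> 'h"
  assumes lin: "\<And>t. t \<ge> 0 \<Longrightarrow> linear (S t)"
    and contraction: "\<And>t x. t \<ge> 0 \<Longrightarrow> norm (S t x) \<le> norm x"
    and S0: "S 0 = id"
    and S_add: "\<And>s t. s \<ge> 0 \<Longrightarrow> t \<ge> 0 \<Longrightarrow> S (s + t) = S s \<circ> S t"
    and deriv: "((\<lambda>t. (S t x - x) /\<^sub>R t) \<longlongrightarrow> a *\<^sub>R x) (at_right 0)"
    and "a \<le> 0" "t \<ge> 0"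
  shows "S t x = exp (a * t) *\<^sub>R x"
proof (cases "t = 0")
  case True
  then show ?thesis by (simp add: S0)
next
  case False
  with \<open>t \<ge> 0\<close> have "t > 0" by simp
  define d where "d h = norm (S h x - exp (a * h) *\<^sub>R x)" for h
  have steps: "norm (S (real n * h) x - exp (a * (real n * h)) *\<^sub>R x) \<le> real n * d h"
    if "h \<ge> 0" for n h
  proof (induction n)
    case 0
    show ?case by (simp add: S0)
  next
    case (Suc n)
    have nh: "real n * h \<ge> 0" using that by simp
    have "S (real n * h + h) x - exp (a * (real n * h + h)) *\<^sub>R x
        = S (real n * h) (S h x - exp (a * h) *\<^sub>R x)
          + exp (a * h) *\<^sub>R (S (real n * h) x - exp (a * (real n * h)) *\<^sub>R x)"
      using S_add[OF nh that] linear_diff[OF lin[OF nh]] linear_scale[OF lin[OF nh]]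
      by (simp add: scaleR_diff_right distrib_left exp_add mult.commute)
    also have "norm \<dots> \<le> norm (S h x - exp (a * h) *\<^sub>R x)
        + exp (a * h) * norm (S (real n * h) x - exp (a * (real n * h)) *\<^sub>R x)"
      by (rule norm_triangle_le) (simp add: contraction[OF nh])
    also have "\<dots> \<le> d h + 1 * (real n * d h)"
    proof -
      have "exp (a * h) \<le> 1"
        using \<open>a \<le> 0\<close> that by (simp add: mult_nonpos_nonneg)
      then show ?thesis
        using Suc.IH by (intro add_mono mult_mono) (simp_all add: d_def)
    qed
    finally show ?case by (simp add: algebra_simps)
  qed
  have "((\<lambda>h. exp (a * h)) has_real_derivative a) (at 0)"
    by (auto intro!: derivative_eq_intros)
  then have "((\<lambda>h. (exp (a * h) - 1) / h) \<longlongrightarrow> a) (at_right 0)"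
    by (auto simp: DERIV_def intro: filterlim_mono[OF _ order_refl at_le])
  then have "((\<lambda>h. (S h x - x) /\<^sub>R h - ((exp (a * h) - 1) / h) *\<^sub>R x) \<longlongrightarrow> a *\<^sub>R x - a *\<^sub>R x) (at_right 0)"
    by (intro tendsto_intros deriv)
  then have "((\<lambda>h. norm ((S h x - x) /\<^sub>R h - ((exp (a * h) - 1) / h) *\<^sub>R x)) \<longlongrightarrow> 0) (at_right 0)"
    by (simp add: tendsto_norm_zero_iff)
  moreover have "norm ((S h x - x) /\<^sub>R h - ((exp (a * h) - 1) / h) *\<^sub>R x) = d h / h" if "h > 0" for h
  proof -
    have "(S h x - x) /\<^sub>R h - ((exp (a * h) - 1) / h) *\<^sub>R x = (S h x - exp (a * h) *\<^sub>R x) /\<^sub>R h"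
      by (simp add: algebra_simps divide_inverse)
    then show ?thesis
      using that by (simp add: d_def divide_inverse mult.commute)
  qed
  ultimately have o: "((\<lambda>h. d h / h) \<longlongrightarrow> 0) (at_right 0)"
    by (subst (asm) tendsto_cong[where g = "\<lambda>h. d h / h"]) (auto simp: eventually_at_right_less eventually_at_filter)
  have "filterlim (\<lambda>n. t / real (Suc n)) (at_right 0) sequentially"
    using \<open>t > 0\<close> LIMSEQ_Suc[OF lim_const_over_n[of t]]
    by (auto simp: filterlim_at)
  then have "(\<lambda>n. t * (d (t / real (Suc n)) / (t / real (Suc n)))) \<longlonglongrightarrow> t * 0"
    by (intro tendsto_intros filterlim_compose[OF o])
  moreover have "t * (d (t / real (Suc n)) / (t / real (Suc n))) = real (Suc n) * d (t / real (Suc n))" for n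
    using \<open>t > 0\<close> by simp
  ultimately have lim: "(\<lambda>n. real (Suc n) * d (t / real (Suc n))) \<longlonglongrightarrow> 0"
    by simp
  have "norm (S t x - exp (a * t) *\<^sub>R x) \<le> real (Suc n) * d (t / real (Suc n))" for n
    using steps[of "t / real (Suc n)" "Suc n"] \<open>t > 0\<close> by simp
  then have "norm (S t x - exp (a * t) *\<^sub>R x) \<le> 0"
    by (intro LIMSEQ_le_const[OF lim]) auto
  then show ?thesis by simp
qed

text \<open>Both sides are continuous and linear in \<open>y\<close>, and by orthogonality they agree when \<open>y\<close> is one of
  the \<open>\<phi> k\<close>; the span of these vectors is dense.\<close>

lemma (in hilbert_space) ip_diagonal_operator:
  assumes \<phi>: "complete_orthonormal scl ip \<phi>"
    and T: "bounded_operator scl T"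
    and eig: "\<And>k. T (\<phi> k) = c k *\<^sub>R \<phi> k"
  shows "ip (\<phi> j) (T y) = c j *\<^sub>R ip (\<phi> j) y"
proof -
  let ?E = "{y. ip (\<phi> j) (T y) = c j *\<^sub>R ip (\<phi> j) y}"
  have blT: "bounded_linear T" and Tscl: "\<And>c x. T (scl c x) = scl c (T x)"
    using T by (auto simp: bounded_operator_def)
  note bl = bounded_linear_ip[OF norm_orthonormal[OF \<phi>]]
  have "subspace ?E"
    by (rule subspaceI)
       (simp_all add: linear_0[OF bounded_linear.linear[OF blT]] linear_add[OF bounded_linear.linear[OF blT]]
         linear_0[OF bounded_linear.linear[OF bl]] ip_add_right scaleR_add_right Tscl ip_scale_right)
  moreover have "range \<phi> \<subseteq> ?E"
    using \<phi> by (auto simp: complete_orthonormal_def eig ip_scaleR_right)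
  ultimately have "span (range \<phi>) \<subseteq> ?E"
    by (intro span_minimal)
  moreover have "closed ?E"
    by (intro closed_Collect_eq continuous_intros
        linear_continuous_on[OF bl] linear_continuous_on[OF bounded_linear_compose[OF bl blT]])
  ultimately have "closure (span (range \<phi>)) \<subseteq> ?E"
    by (rule closure_minimal)
  then show ?thesis
    using \<phi> by (auto simp: complete_orthonormal_def)
qed

theorem theorem3p3:
  fixes scl :: "'k::{real_normed_field, euclidean_space} \<Rightarrow> 'h::banach \<Rightarrow> 'h"
    and ip :: "'h \<Rightarrow> 'h \<Rightarrow> 'k"
    and D :: "'h set" and L :: "'h \<Rightarrow> 'h"
    and \<gamma> :: real
    and \<phi> :: "nat \<Rightarrow> 'h" and ev :: "nat \<Rightarrow> real"
    and S :: "real \<Rightarrow> 'h \<Rightarrow> 'h"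
    and Q P :: "'h \<Rightarrow> 'h"
    and N :: nat
  assumes "hilbert_space scl ip"
    and "densely_defined_linear scl D L"
    and "self_adjoint ip D L"
    and "\<gamma> > 0"
    and "\<forall>x\<in>D. ip x (L x) \<le>\<^sub>K of_real (- \<gamma> * (norm x)\<^sup>2)"
    and "complete_orthonormal scl ip \<phi>"
    and "\<forall>k. \<phi> k \<in> D \<and> L (\<phi> k) = scl (of_real (ev k)) (\<phi> k) \<and> ev k < 0"
    and "strongly_continuous_semigroup scl S"
    and "generates D L S"
    and "\<forall>t\<ge>0. onorm (S t) \<le> exp (- \<gamma> * t)"
    and "bounded_operator scl Q"
    and "positive_operator ip Q"
    and "self_adjoint ip UNIV Q"
    and "energy_covariance ip S Q P"
    and "N \<ge> 1"
  shows "mat_diag N (\<lambda>k. of_real (ev k)) * op_mat ip \<phi> N P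
       + op_mat ip \<phi> N P * mat_diag N (\<lambda>k. of_real (ev k)) = - op_mat ip \<phi> N Q"
proof -
  interpret hilbert_space scl ip by fact
  note \<phi> = \<open>complete_orthonormal scl ip \<phi>\<close>
  have bop: "bounded_operator scl (S t)" if "t \<ge> 0" for t
    using assms(8) that by (simp add: strongly_continuous_semigroup_def)
  then have bl: "bounded_linear (S t)" if "t \<ge> 0" for t
    using that by (simp add: bounded_operator_def)
  have contraction: "norm (S t x) \<le> norm x" if "t \<ge> 0" for t x
  proof -
    have "onorm (S t) \<le> exp (- \<gamma> * t)"
      using assms(10) that by blast
    also have "\<dots> \<le> 1"
      using \<open>\<gamma> > 0\<close> that by simp
    finally have "onorm (S t) * norm x \<le> 1 * norm x"
      by (rule mult_right_mono) simp
    then show ?thesis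
      using onorm[OF bl[OF that], of x] by simp
  qed
  have eig: "S t (\<phi> k) = exp (ev k * t) *\<^sub>R \<phi> k" if "t \<ge> 0" for t k
  proof (rule semigroup_eigenvector)
    have "((\<lambda>t. (S t (\<phi> k) - \<phi> k) /\<^sub>R t) \<longlongrightarrow> L (\<phi> k)) (at_right 0)"
      using assms(7,9) unfolding generates_def by blast
    then show "((\<lambda>t. (S t (\<phi> k) - \<phi> k) /\<^sub>R t) \<longlongrightarrow> ev k *\<^sub>R \<phi> k) (at_right 0)"
      using assms(7) by (simp add: scale_of_real)
    show "ev k \<le> 0"
      using assms(7) less_imp_le by blast
    show "S 0 = id" "\<And>s t. s \<ge> 0 \<Longrightarrow> t \<ge> 0 \<Longrightarrow> S (s + t) = S s \<circ> S t"
      using assms(8) unfolding strongly_continuous_semigroup_def by blast+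
  qed (fact bounded_linear.linear[OF bl] contraction that)+
  have entry: "(ev j + ev k) *\<^sub>R ip (\<phi> j) (P (\<phi> k)) = - ip (\<phi> j) (Q (\<phi> k))" for j k
  proof -
    define q where "q = ip (\<phi> j) (Q (\<phi> k))"
    have neg: "ev j + ev k < 0"
      using assms(7) by (simp add: add_neg_neg)
    have integrand: "ip (\<phi> j) (S t (Q (S t (\<phi> k)))) = exp ((ev j + ev k) * t) *\<^sub>R q" if "t \<ge> 0" for t
    proof -
      have "Q (S t (\<phi> k)) = exp (ev k * t) *\<^sub>R Q (\<phi> k)"
        using \<open>bounded_operator scl Q\<close>
        by (simp add: eig[OF that] bounded_operator_def linear_scale bounded_linear.linear)
      then show ?thesis
        by (simp add: ip_diagonal_operator[OF \<phi> bop[OF that] eig[OF that]] q_def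
            ip_scaleR_right distrib_right exp_add)
    qed
    have "ip (\<phi> j) (P (\<phi> k)) = (LINT t:{0..}|lborel. ip (\<phi> j) (S t (Q (S t (\<phi> k)))))"
      using assms(14) by (simp add: energy_covariance_def)
    also have "\<dots> = (LINT t:{0..}|lborel. exp ((ev j + ev k) * t) *\<^sub>R q)"
      by (intro set_lebesgue_integral_cong) (auto simp: integrand)
    also have "\<dots> = (LINT t:{0..}|lborel. exp ((ev j + ev k) * t)) *\<^sub>R q"
      using integral_scaleR_left[of q lborel "\<lambda>t. indicator {0..} t *\<^sub>R exp ((ev j + ev k) * t)"]
        set_integral_exp_Ici(1)[OF neg]
      by (simp add: set_lebesgue_integral_def set_integrable_def)
    also have "\<dots> = (- 1 / (ev j + ev k)) *\<^sub>R q"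
      by (simp add: set_integral_exp_Ici(2)[OF neg])
    finally show ?thesis
      using neg by (simp add: q_def)
  qed
  show ?thesis
  proof (rule eq_matI)
    fix j k
    assume "j < dim_row (- op_mat ip \<phi> N Q)" "k < dim_col (- op_mat ip \<phi> N Q)"
    then have jk: "j < N" "k < N"
      by (simp_all add: op_mat_def)
    have carrier: "op_mat ip \<phi> N P \<in> carrier_mat N N"
      by (simp add: op_mat_def)
    have "of_real (ev j) * ip (\<phi> j) (P (\<phi> k)) + ip (\<phi> j) (P (\<phi> k)) * of_real (ev k)
        = - ip (\<phi> j) (Q (\<phi> k))"
      using entry[of j k] by (simp add: scaleR_conv_of_real algebra_simps)
    then show "(mat_diag N (\<lambda>k. of_real (ev k)) * op_mat ip \<phi> N P
        + op_mat ip \<phi> N P * mat_diag N (\<lambda>k. of_real (ev k))) $$ (j, k) = (- op_mat ip \<phi> N Q) $$ (j, k)"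
      using jk by (simp add: mat_diag_mult_left[OF carrier] mat_diag_mult_right[OF carrier])
        (simp add: op_mat_def)
  qed (simp_all add: op_mat_def mat_diag_def)
qed

end
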